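(* Let $K$ be a field. If $\mathcal{C}$ is a complete admissible uniform clutter with vertex set $X$, then its edge ideal $I=I(\mathcal{C})\subset K[X]$ is normally torsion free (i.e. $I^i=I^{(i)}$ for all $i\geq 1$) and normal (i.e. $I^i=\overline{I^i}$ for all $i\geq 1$).
   Context: Let $d\geq 2$, $g\geq 2$ be integers and let $X^1=\{x_1^1,\ldots,x_g^1\}$, $X^2=\{x_1^2,\ldots,x_g^2\}$, $\ldots$, $X^d=\{x_1^d,\ldots,x_g^d\}$ be disjoint sets of variables (superscripts are indices). The clutter $\mathcal{C}$ with vertex set $X=X^1\cup\cdots\cup X^d$ and edge set $$E(\mathcal{C})=\{\{x_{i_1}^1,x_{i_2}^2,\ldots,x_{i_d}^d\}\mid 1\leq i_1\leq i_2\leq\cdots\leq i_d\leq g\}$$ is called a complete admissible uniform clutter. The edge ideal $I(\mathcal{C})$ is the ideal of the polynomial ring $K[X]$ generated by all monomials $\prod_{x\in e}x$ with $e\in E(\mathcal{C})$. If $C_1,\ldots,C_s$ are the minimal vertex covers of $\mathcal{C}$ (minimal sets of vertices meeting every edge) and $\mathfrak{p}_k$ is the ideal generated by $C_k$, the $i$th symbolic power of $I=I(\mathcal{C})$ is $I^{(i)}=\mathfrak{p}_1^i\cap\cdots\cap\mathfrak{p}_s^i$. The integral closure $\overline{I^i}$ is the ideal generated by all monomials $m$ such that $m^p\in I^{pi}$ for some $p\geq 1$. *)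

theory Defs
  imports "HOL-Algebra.Ideal_Product" "HOL-Library.Poly_Mapping" "HOL-Library.FuncSet"
begin

type_synonym ('v, 'k) mpoly = "('v \<Rightarrow>\<^sub>0 nat) \<Rightarrow>\<^sub>0 'k"

definition Var :: "'v \<Rightarrow> ('v, 'k::comm_ring_1) mpoly"
  where "Var x = Poly_Mapping.single (Poly_Mapping.single x 1) 1"

(* K[V], as the subring of those polynomials whose exponent vectors are supported in V. *)
definition mpoly_ring :: "'v set \<Rightarrow> ('v, 'k::comm_ring_1) mpoly ring"
  where "mpoly_ring V =
    \<lparr> carrier = {p. \<forall>t \<in> Poly_Mapping.keys p. Poly_Mapping.keys t \<subseteq> V},
      mult = (*), one = 1, zero = 0, add = (+) \<rparr>"

lemma cring_mpoly_ring: "cring (mpoly_ring V :: ('v, 'k::comm_ring_1) mpoly ring)"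
proof (rule cringI)
  let ?R = "mpoly_ring V :: ('v, 'k) mpoly ring"
  have add: "x + y \<in> carrier ?R" if "x \<in> carrier ?R" "y \<in> carrier ?R" for x y
    using that Poly_Mapping.keys_add[of x y] by (auto simp: mpoly_ring_def)
  have neg: "- x \<in> carrier ?R" if "x \<in> carrier ?R" for x
    using that by (simp add: mpoly_ring_def)
  have mult: "x * y \<in> carrier ?R" if "x \<in> carrier ?R" "y \<in> carrier ?R" for x y
  proof -
    have "Poly_Mapping.keys t \<subseteq> V" if t: "t \<in> Poly_Mapping.keys (x * y)" for t
    proof -
      obtain a b where "t = a + b" "a \<in> Poly_Mapping.keys x" "b \<in> Poly_Mapping.keys y"
        using t Poly_Mapping.keys_mult[of x y] by blast
      then show ?thesis
        using \<open>x \<in> carrier ?R\<close> \<open>y \<in> carrier ?R\<close> Poly_Mapping.keys_add[of a b]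
        unfolding mpoly_ring_def by (simp, blast)
    qed
    then show ?thesis by (simp add: mpoly_ring_def)
  qed
  have ops: "x \<oplus>\<^bsub>?R\<^esub> y = x + y" "x \<otimes>\<^bsub>?R\<^esub> y = x * y" "\<zero>\<^bsub>?R\<^esub> = 0" "\<one>\<^bsub>?R\<^esub> = 1" for x y
    by (simp_all add: mpoly_ring_def)
  have zero: "0 \<in> carrier ?R" and one: "1 \<in> carrier ?R"
    by (simp_all add: mpoly_ring_def)
  show "abelian_group ?R"
    by (rule abelian_groupI; unfold ops)
      (blast intro: add zero neg add.assoc add.commute add_0_left left_minus)+
  show "Group.comm_monoid ?R"
    by (rule comm_monoidI; unfold ops)
      (blast intro: mult one mult.assoc mult.commute mult_1_left)+
  show "(x \<oplus>\<^bsub>?R\<^esub> y) \<otimes>\<^bsub>?R\<^esub> z = x \<otimes>\<^bsub>?R\<^esub> z \<oplus>\<^bsub>?R\<^esub> y \<otimes>\<^bsub>?R\<^esub> z" for x y z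
    unfolding ops by (rule distrib_right)
qed

abbreviation ideal_power :: "'v set \<Rightarrow> ('v, 'k::comm_ring_1) mpoly set \<Rightarrow> nat \<Rightarrow> ('v, 'k) mpoly set"
  where "ideal_power V I i \<equiv> I [^]\<^bsub>ideals_set (mpoly_ring V)\<^esub> i"

(* Injectivity says that the sets {x j 1, ..., x j g} have g elements each and are pairwise disjoint. *)
definition complete_admissible_uniform_clutter ::
    "nat \<Rightarrow> nat \<Rightarrow> 'v set \<Rightarrow> 'v set set \<Rightarrow> bool"
  where "complete_admissible_uniform_clutter d g V E \<longleftrightarrow>
    (\<exists>x :: nat \<Rightarrow> nat \<Rightarrow> 'v.
      inj_on (\<lambda>(j, k). x j k) ({1..d} \<times> {1..g}) \<and>
      V = (\<Union>j\<in>{1..d}. x j ` {1..g}) \<and>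
      E = {(\<lambda>j. x j (i j)) ` {1..d} | i. i \<in> {1..d} \<rightarrow> {1..g} \<and> mono_on {1..d} i})"

definition edge_ideal :: "'v set \<Rightarrow> 'v set set \<Rightarrow> ('v, 'k::comm_ring_1) mpoly set"
  where "edge_ideal V E = Idl\<^bsub>mpoly_ring V\<^esub> ((\<lambda>e. \<Prod>x\<in>e. Var x) ` E)"

definition vertex_cover :: "'v set \<Rightarrow> 'v set set \<Rightarrow> 'v set \<Rightarrow> bool"
  where "vertex_cover V E C \<longleftrightarrow> C \<subseteq> V \<and> (\<forall>e\<in>E. C \<inter> e \<noteq> {})"

definition minimal_vertex_cover :: "'v set \<Rightarrow> 'v set set \<Rightarrow> 'v set \<Rightarrow> bool"
  where "minimal_vertex_cover V E C \<longleftrightarrow>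
    vertex_cover V E C \<and> (\<forall>C'. C' \<subset> C \<longrightarrow> \<not> vertex_cover V E C')"

(* The symbolic power of the edge ideal of (V, E). *)
definition symbolic_power :: "'v set \<Rightarrow> 'v set set \<Rightarrow> nat \<Rightarrow> ('v, 'k::comm_ring_1) mpoly set"
  where "symbolic_power V E i =
    {f \<in> carrier (mpoly_ring V).
      \<forall>C. minimal_vertex_cover V E C \<longrightarrow> f \<in> ideal_power V (Idl\<^bsub>mpoly_ring V\<^esub> (Var ` C)) i}"

definition monomials :: "'v set \<Rightarrow> ('v, 'k::comm_ring_1) mpoly set"
  where "monomials V = {Poly_Mapping.single t 1 | t. Poly_Mapping.keys t \<subseteq> V}"

(* The integral closure of the i-th power of a monomial ideal I of K[V]. *)
definition integral_closure_power ::
    "'v set \<Rightarrow> ('v, 'k::comm_ring_1) mpoly set \<Rightarrow> nat \<Rightarrow> ('v, 'k) mpoly set"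
  where "integral_closure_power V I i =
    Idl\<^bsub>mpoly_ring V\<^esub> {m \<in> monomials V. \<exists>p\<ge>1. m ^ p \<in> ideal_power V I (p * i)}"

(* For the edge ideal I of (V, E); I is an argument because it determines the coefficient field. *)
definition normally_torsion_free :: "'v set \<Rightarrow> 'v set set \<Rightarrow> ('v, 'k::comm_ring_1) mpoly set \<Rightarrow> bool"
  where "normally_torsion_free V E I \<longleftrightarrow> (\<forall>i\<ge>1. ideal_power V I i = symbolic_power V E i)"

definition normal_monomial_ideal :: "'v set \<Rightarrow> ('v, 'k::comm_ring_1) mpoly set \<Rightarrow> bool"
  where "normal_monomial_ideal V I \<longleftrightarrow>
    (\<forall>i\<ge>1. ideal_power V I i = integral_closure_power V I i)"

end

theory Submission
  imports Defs
begin

text \<open>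
  The \<open>i\<close>-th power of the edge ideal consists of the polynomials whose exponent vectors have weight
  at least \<open>i\<close> on each vertex cover; both the symbolic power and the integral closure lie in this
  set. The nontrivial inclusion removes edges from an exponent vector one at a time. It only needs
  the staircase covers: for \<open>0 = l\<^sub>0 \<le> l\<^sub>1 \<le> \<dots> \<le> l\<^sub>d = g\<close>, the cover consists of the rows
  \<open>l\<^sub>j\<^sub>-\<^sub>1 < k \<le> l\<^sub>j\<close> of each layer \<open>j\<close>. The edge to remove is the greedy one, which in each layer takes
  the lowest row of positive weight that is not below the previous choice; an uncrossing argument
  shows that the minimal weight of a staircase cover drops by at most one.
\<close>

section \<open>Staircases and chains\<close>

definition staircase :: "nat \<Rightarrow> nat \<Rightarrow> (nat \<Rightarrow> nat) \<Rightarrow> bool"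
  where "staircase d g l \<longleftrightarrow> mono_on {0..d} l \<and> l 0 = 0 \<and> l d = g"

text \<open>This is the weight on a staircase cover of the monomial with exponent
  \<open>t j k\<close> at row \<open>k\<close> of layer \<open>j\<close>. Working with indices
  instead of variables keeps the combinatorics free of the polynomial ring.\<close>

definition staircase_weight :: "nat \<Rightarrow> (nat \<Rightarrow> nat \<Rightarrow> nat) \<Rightarrow> (nat \<Rightarrow> nat) \<Rightarrow> nat"
  where "staircase_weight d t l = (\<Sum>j\<in>{1..d}. \<Sum>k\<in>{l (j - 1)<..l j}. t j k)"

text \<open>The value exceeds \<open>g\<close> once the chain cannot be continued.\<close>

fun greedy :: "nat \<Rightarrow> (nat \<Rightarrow> nat \<Rightarrow> nat) \<Rightarrow> nat \<Rightarrow> nat" where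
  "greedy g t 0 = 1"
| "greedy g t (Suc j) = (LEAST k. greedy g t j \<le> k \<and> (g < k \<or> 0 < t (Suc j) k))"

lemma greedy_Suc:
  "greedy g t j \<le> greedy g t (Suc j)"
  "g < greedy g t (Suc j) \<or> 0 < t (Suc j) (greedy g t (Suc j))"
proof -
  \<comment> \<open>A row beyond \<open>g\<close> is always admissible, so the \<open>LEAST\<close>
    in \<open>greedy\<close> is attained.\<close>
  have "greedy g t j \<le> max (greedy g t j) (Suc g) \<and>
      (g < max (greedy g t j) (Suc g) \<or> 0 < t (Suc j) (max (greedy g t j) (Suc g)))"
    by auto
  from LeastI[of "\<lambda>k. greedy g t j \<le> k \<and> (g < k \<or> 0 < t (Suc j) k)", OF this]
  show "greedy g t j \<le> greedy g t (Suc j)"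
    "g < greedy g t (Suc j) \<or> 0 < t (Suc j) (greedy g t (Suc j))"
    by auto
qed

lemma greedy_skips_zero:
  assumes "greedy g t j \<le> k" "k < greedy g t (Suc j)"
  shows "t (Suc j) k = 0"
  using not_less_Least[of k "\<lambda>k. greedy g t j \<le> k \<and> (g < k \<or> 0 < t (Suc j) k)"] assms
  by simp

lemma greedy_le: "greedy g t j \<le> Suc g"
proof (induction j)
  case (Suc j)
  then show ?case
    by (simp add: Least_le)
qed simp

lemma greedy_mono: "i \<le> j \<Longrightarrow> greedy g t i \<le> greedy g t j"
  using lift_Suc_mono_le[of "greedy g t"] greedy_Suc(1) by blast

lemma greedy_ge_1: "1 \<le> greedy g t j"
  using greedy_mono[of 0 j] by simp

text \<open>When the chain gets stuck, the rows it skipped form a staircase themselves, and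
  \<open>t\<close> vanishes on all of them. Thus a positive weight on every staircase forces the
  chain to reach layer \<open>d\<close> within the rows up to \<open>g\<close>.\<close>

lemma greedy_lt_imp_weight_zero:
  assumes "1 \<le> d" "g < greedy g t d"
  obtains l where "staircase d g l" "staircase_weight d t l = 0"
proof
  \<comment> \<open>The shift by one turns the rows from \<open>greedy g t (j - 1)\<close> up to
    just below \<open>greedy g t j\<close> into the interval of layer \<open>j\<close>. The start
    value 1 becomes 0, and the stuck value \<open>Suc g\<close> becomes \<open>g\<close>.\<close>
  let ?l = "\<lambda>j. greedy g t j - 1"
  show "staircase d g ?l"
    using assms greedy_le[of g t d] greedy_mono[of _ _ g t]
    by (auto simp: staircase_def mono_on_def intro: diff_le_mono)
  have "t j k = 0" if "j \<in> {1..d}" "k \<in> {?l (j - 1)<..?l j}" for j k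
    using greedy_skips_zero[of g t "j - 1" k] that by (cases j) auto
  then show "staircase_weight d t ?l = 0"
    unfolding staircase_weight_def by (intro sum.neutral ballI) auto
qed

text \<open>
  The witness \<open>l'\<close> uncrosses \<open>l\<close> with the greedy chain: it drops below the chain before the last
  layer where the two meet. The points gained lie strictly between consecutive values of the
  chain, where \<open>t\<close> vanishes.
\<close>

lemma staircase_weight_greedy_removed:
  assumes l: "staircase d g l"
    and i: "\<And>l. staircase d g l \<Longrightarrow> Suc i \<le> staircase_weight d t l"
    and t': "\<And>j k. t' j k = t j k - of_bool (k = greedy g t j)"
  shows "i \<le> staircase_weight d t' l"
proof -
  let ?c = "greedy g t"
  \<comment> \<open>These are the layers in which the chain runs through the staircase, the only
    ones where passing to \<open>t'\<close> can lower the weight of \<open>l\<close>.\<close>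
  define M where "M = {j\<in>{1..d}. l (j - 1) < ?c j \<and> ?c j \<le> l j}"
  have avoid: "(\<Sum>k\<in>{l (j - 1)<..l j}. t' j k) = (\<Sum>k\<in>{l (j - 1)<..l j}. t j k)"
    if "j \<in> {1..d}" "j \<notin> M" for j
    using that by (intro sum.cong) (auto simp: M_def t')
  show ?thesis
  proof (cases "M = {}")
    case True
    then have "staircase_weight d t' l = staircase_weight d t l"
      unfolding staircase_weight_def by (intro sum.cong refl avoid) auto
    then show ?thesis
      using i[OF l] by simp
  next
    case False
    define j where "j = Max M"
    have "finite M" by (simp add: M_def)
    then have jM: "j \<in> M" and after: "\<And>m. m \<in> M \<Longrightarrow> m \<le> j"
      using False by (auto simp: j_def)
    define l' where "l' m = (if m < j then min (l m) (?c m - 1) else l m)" for m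
    have lmono: "l a \<le> l b" if "a \<le> b" "b \<le> d" for a b
      using l that by (auto simp: staircase_def mono_on_def)
    have "staircase d g l'"
      unfolding staircase_def mono_on_def
    proof (intro conjI allI impI)
      fix a b assume "a \<in> {0..d} \<and> b \<in> {0..d} \<and> a \<le> b"
      then show "l' a \<le> l' b"
        using lmono[of a b] greedy_mono[of a b g t] by (auto simp: l'_def)
    qed (use l jM in \<open>auto simp: l'_def staircase_def M_def\<close>)
    \<comment> \<open>A gained row satisfies \<open>l' (m - 1) < k\<close> and
      \<open>k \<le> l (m - 1)\<close>, so \<open>l' (m - 1)\<close> is the cut-off value
      \<open>?c (m - 1) - 1\<close> and \<open>k\<close> is at least \<open>?c (m - 1)\<close>. It
      is also below \<open>?c m\<close>: by the cut-off if \<open>m < j\<close>, and by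
      \<open>l (j - 1) < ?c j\<close> if \<open>m = j\<close>.\<close>
    have gain: "t m k = 0"
      if "m \<in> {1..j}" "k \<in> {l' (m - 1)<..l' m}" "k \<notin> {l (m - 1)<..l m}" for m k
    proof -
      have "?c (m - 1) \<le> k" "k < ?c m"
        using that jM greedy_ge_1[of g t m] by (auto simp: l'_def M_def split: if_splits)
      then show ?thesis
        using greedy_skips_zero[of g t "m - 1" k] that by (cases m) auto
    qed
    \<comment> \<open>Before layer \<open>j\<close>, the staircase \<open>l'\<close> stays strictly
      below the chain, so its rows never lose weight. Layer \<open>j\<close> contains the chain
      point, which costs at most one. After it, \<open>l'\<close> agrees with \<open>l\<close> and
      the chain is not met again. Summing over the layers gives a total loss of at most one.\<close>
    have layer: "(\<Sum>k\<in>{l' (m - 1)<..l' m}. t m k)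
        \<le> (\<Sum>k\<in>{l (m - 1)<..l m}. t' m k) + of_bool (m = j)" (is "?L \<le> ?R")
      if m: "m \<in> {1..d}" for m
    proof -
      let ?J = "{l (m - 1)<..l m}" and ?J' = "{l' (m - 1)<..l' m}"
      consider "m < j" | "m = j" | "m > j" by linarith
      then show ?thesis
      proof cases
        case 1
        have "?L = (\<Sum>k\<in>?J' \<inter> ?J. t m k)"
          using gain[of m] 1 m by (intro sum.mono_neutral_right) auto
        also have "\<dots> = (\<Sum>k\<in>?J' \<inter> ?J. t' m k)"
          using 1 greedy_ge_1[of g t m] by (intro sum.cong) (auto simp: l'_def t')
        also have "\<dots> \<le> (\<Sum>k\<in>?J. t' m k)"
          by (intro sum_mono2) auto
        finally show ?thesis by simp
      next
        case 2
        have "?L = (\<Sum>k\<in>?J' \<inter> ?J. t m k)"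
          using gain[of m] 2 m by (intro sum.mono_neutral_right) auto
        also have "\<dots> \<le> (\<Sum>k\<in>?J. t m k)"
          by (intro sum_mono2) auto
        also have "\<dots> \<le> (\<Sum>k\<in>?J. t' m k + of_bool (k = ?c m))"
          by (intro sum_mono) (auto simp: t')
        also have "\<dots> \<le> (\<Sum>k\<in>?J. t' m k) + 1"
          by (simp add: sum.distrib of_bool_def)
        finally show ?thesis using 2 by simp
      next
        case 3
        then have "m \<notin> M" using after by force
        then show ?thesis using avoid[OF m] 3 by (simp add: l'_def)
      qed
    qed
    have "Suc i \<le> staircase_weight d t l'"
      using i \<open>staircase d g l'\<close> .
    also have "\<dots> \<le> (\<Sum>m\<in>{1..d}. (\<Sum>k\<in>{l (m - 1)<..l m}. t' m k) + of_bool (m = j))"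
      unfolding staircase_weight_def by (intro sum_mono layer)
    also have "\<dots> \<le> staircase_weight d t' l + 1"
      by (simp add: sum.distrib staircase_weight_def of_bool_def)
    finally show ?thesis by simp
  qed
qed

text \<open>The greedy chain serves as \<open>c\<close>. It cannot get stuck, since that would give
  a staircase of weight zero against the bound \<open>Suc i\<close>; the remaining bound is the
  uncrossing argument.\<close>

lemma removable_chain:
  assumes "1 \<le> d"
    and i: "\<And>l. staircase d g l \<Longrightarrow> Suc i \<le> staircase_weight d t l"
  obtains c where "c \<in> {1..d} \<rightarrow> {1..g}" "mono_on {1..d} c"
    "\<And>j. j \<in> {1..d} \<Longrightarrow> 0 < t j (c j)"
    "\<And>l. staircase d g l \<Longrightarrow> i \<le> staircase_weight d (\<lambda>j k. t j k - of_bool (k = c j)) l"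
proof
  let ?c = "greedy g t"
  have "?c d \<le> g"
  proof (rule ccontr)
    assume "\<not> ?c d \<le> g"
    then obtain l where "staircase d g l" "staircase_weight d t l = 0"
      using greedy_lt_imp_weight_zero[OF assms(1)] by (metis not_le)
    then show False using i[of l] by simp
  qed
  then have le: "?c j \<le> g" if "j \<le> d" for j
    using greedy_mono[OF that, of g t] by simp
  then show "?c \<in> {1..d} \<rightarrow> {1..g}"
    using greedy_ge_1[of g t] by auto
  show "mono_on {1..d} ?c"
    by (auto simp: mono_on_def intro: greedy_mono)
  show "0 < t j (?c j)" if "j \<in> {1..d}" for j
    using greedy_Suc(2)[of g t "j - 1"] le[of j] that by (cases j) auto
qed (rule staircase_weight_greedy_removed[OF _ i], auto)

text \<open>A discrete intermediate value argument: take the first layer with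
  \<open>c j \<le> l j\<close>, which exists because \<open>c d \<le> g = l d\<close>. In the layer
  before, \<open>c\<close> is still above \<open>l\<close>, and \<open>c\<close> is
  monotone.\<close>

lemma staircase_meets_chain:
  assumes "staircase d g l" "1 \<le> d" "c \<in> {1..d} \<rightarrow> {1..g}" "mono_on {1..d} c"
  obtains j where "j \<in> {1..d}" "l (j - 1) < c j" "c j \<le> l j"
proof -
  let ?P = "\<lambda>j. j \<in> {1..d} \<and> c j \<le> l j"
  define j where "j = (LEAST j. ?P j)"
  have "?P d" using assms by (auto simp: staircase_def)
  then have j: "?P j" unfolding j_def by (rule LeastI)
  have "l (j - 1) < c j"
  proof (cases "j = 1")
    \<comment> \<open>The first layer has no predecessor; there \<open>l 0 = 0\<close> lies below
      every row.\<close>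
    case True
    then have "1 \<le> c j" using assms(3) j by auto
    then show ?thesis using assms(1) True by (simp add: staircase_def)
  next
    case False
    then have "\<not> ?P (j - 1)"
      using j unfolding j_def by (intro not_less_Least) auto
    moreover have "c (j - 1) \<le> c j"
      using j False by (intro mono_onD[OF assms(4)]) auto
    ultimately show ?thesis using j False by auto
  qed
  then show thesis using that j by blast
qed

section \<open>Monomials and powers of ideals\<close>

lemma mpoly_ring_simps [simp]:
  "x \<oplus>\<^bsub>mpoly_ring V\<^esub> y = x + y" "x \<otimes>\<^bsub>mpoly_ring V\<^esub> y = x * y"
  "\<zero>\<^bsub>mpoly_ring V\<^esub> = 0" "\<one>\<^bsub>mpoly_ring V\<^esub> = 1"
  by (simp_all add: mpoly_ring_def)

lemma ring_mpoly_ring: "ring (mpoly_ring V :: ('v, 'k::comm_ring_1) mpoly ring)"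
  using cring_mpoly_ring by (rule cring.axioms)

lemma single_in_mpoly_ring:
  "Poly_Mapping.keys t \<subseteq> V \<Longrightarrow> Poly_Mapping.single t c \<in> carrier (mpoly_ring V)"
  by (simp add: mpoly_ring_def)

lemma Var_in_mpoly_ring: "x \<in> V \<Longrightarrow> Var x \<in> carrier (mpoly_ring V)"
  unfolding Var_def by (rule single_in_mpoly_ring) simp

lemma prod_Var:
  "finite e \<Longrightarrow> (\<Prod>x\<in>e. Var x) = Poly_Mapping.single (\<Sum>x\<in>e. Poly_Mapping.single x 1) 1"
  by (induction rule: finite_induct) (simp_all add: Var_def mult_single)

lemma lookup_sum_single:
  "finite e \<Longrightarrow> Poly_Mapping.lookup (\<Sum>x\<in>e. Poly_Mapping.single x (1::nat)) y = of_bool (y \<in> e)"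
  by (simp add: lookup_sum lookup_single when_def of_bool_def)

lemma keys_sum_single:
  "finite e \<Longrightarrow> Poly_Mapping.keys (\<Sum>x\<in>e. Poly_Mapping.single x (1::nat)) = e"
  by (auto simp: in_keys_iff lookup_sum_single simp del: One_nat_def)

lemma prod_Var_in_mpoly_ring:
  "finite e \<Longrightarrow> e \<subseteq> V \<Longrightarrow> (\<Prod>x\<in>e. Var x) \<in> carrier (mpoly_ring V)"
  unfolding prod_Var by (intro single_in_mpoly_ring) (simp add: keys_sum_single del: One_nat_def)

lemma single_1_power:
  fixes t :: "'v \<Rightarrow>\<^sub>0 nat"
  obtains s where "Poly_Mapping.single t (1::'k::comm_ring_1) ^ p = Poly_Mapping.single s 1"
    "\<And>x. Poly_Mapping.lookup s x = p * Poly_Mapping.lookup t x"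
proof (induction p arbitrary: thesis)
  case 0
  show ?case by (rule 0[of 0]) simp_all
next
  case (Suc p)
  obtain s where "Poly_Mapping.single t (1::'k) ^ p = Poly_Mapping.single s 1"
    "\<And>x. Poly_Mapping.lookup s x = p * Poly_Mapping.lookup t x"
    using Suc.IH by blast
  then show ?case
    by (intro Suc.prems[of "t + s"]) (simp_all add: mult_single lookup_add)
qed

lemma poly_mapping_sum_terms:
  fixes f :: "'a \<Rightarrow>\<^sub>0 'b::comm_monoid_add"
  shows "f = (\<Sum>t\<in>Poly_Mapping.keys f. Poly_Mapping.single t (Poly_Mapping.lookup f t))"
  by (rule poly_mapping_eqI)
    (auto simp: lookup_sum lookup_single when_def in_keys_iff)

lemma sum_mem:
  assumes "0 \<in> A" "\<And>x y. x \<in> A \<Longrightarrow> y \<in> A \<Longrightarrow> x + y \<in> A" "\<And>i. i \<in> S \<Longrightarrow> f i \<in> A"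
  shows "sum f S \<in> A"
  using assms by (induction S rule: infinite_finite_induct) auto

text \<open>Reduces inclusions between ideals to monomials: \<open>f\<close> is the sum of its
  terms, and each term is a monomial times a constant, that is, a polynomial with exponent
  0.\<close>

lemma ideal_mem_if_monomials:
  fixes J :: "('v, 'k::comm_ring_1) mpoly set"
  assumes J: "ideal J (mpoly_ring V)"
    and f: "f \<in> carrier (mpoly_ring V)"
    and mem: "\<And>t. t \<in> Poly_Mapping.keys f \<Longrightarrow> Poly_Mapping.single t 1 \<in> J"
  shows "f \<in> J"
proof -
  interpret ideal J "mpoly_ring V" by fact
  have "Poly_Mapping.single t (Poly_Mapping.lookup f t) \<in> J" if "t \<in> Poly_Mapping.keys f" for t
    using I_l_closed[OF mem[OF that] single_in_mpoly_ring[of 0 V "Poly_Mapping.lookup f t"]]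
    by (simp add: mult_single)
  then have "(\<Sum>t\<in>Poly_Mapping.keys f. Poly_Mapping.single t (Poly_Mapping.lookup f t)) \<in> J"
    by (intro sum_mem) (use additive_subgroup.zero_closed[OF is_additive_subgroup]
      additive_subgroup.a_closed[OF is_additive_subgroup] in auto)
  then show ?thesis using poly_mapping_sum_terms[of f] by simp
qed

lemma ideal_power_0: "ideal_power V I 0 = carrier (mpoly_ring V)"
  by (simp add: ideals_set_def nat_pow_def)

lemma ideal_power_Suc: "ideal_power V I (Suc i) = ideal_power V I i \<cdot>\<^bsub>mpoly_ring V\<^esub> I"
  by (simp add: ideals_set_def nat_pow_def)

lemma ideal_ideal_power:
  assumes "ideal I (mpoly_ring V)"
  shows "ideal (ideal_power V I i) (mpoly_ring V)"
proof (induction i)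
  case 0
  show ?case
    unfolding ideal_power_0 by (rule ring.oneideal[OF ring_mpoly_ring])
next
  case (Suc i)
  then show ?case
    unfolding ideal_power_Suc by (rule ring.ideal_prod_is_ideal[OF ring_mpoly_ring _ assms])
qed

lemma ideal_power_mono:
  assumes "I \<subseteq> J"
  shows "ideal_power V I i \<subseteq> ideal_power V J i"
proof (induction i)
  case (Suc i)
  have "f \<in> ideal_power V J (Suc i)" if "f \<in> ideal_power V I (Suc i)" for f
    using that unfolding ideal_power_Suc
    by (induction rule: ideal_prod.induct) (use Suc assms in \<open>blast intro: ideal_prod.intros\<close>)+
  then show ?case by blast
qed (simp add: ideal_power_0)

text \<open>For finite \<open>C \<subseteq> V\<close> this is the \<open>i\<close>-th power of the
  ideal generated by the variables in \<open>C\<close>, described by a membership test on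
  exponents.\<close>

definition order_ideal :: "'v set \<Rightarrow> 'v set \<Rightarrow> nat \<Rightarrow> ('v, 'k::comm_ring_1) mpoly set"
  where "order_ideal V C i = {f \<in> carrier (mpoly_ring V).
    \<forall>t\<in>Poly_Mapping.keys f. i \<le> (\<Sum>x\<in>C. Poly_Mapping.lookup t x)}"

lemma order_ideal_add:
  assumes "f \<in> order_ideal V C i" "h \<in> order_ideal V C i"
  shows "f + h \<in> order_ideal V C i"
proof -
  interpret cring "mpoly_ring V :: ('a, 'b) mpoly ring" by (rule cring_mpoly_ring)
  have "f + h \<in> carrier (mpoly_ring V)"
    using assms a_closed[of f h] by (simp add: order_ideal_def)
  then show ?thesis
    using assms Poly_Mapping.keys_add[of f h] by (auto simp: order_ideal_def)
qed

lemma order_ideal_mult: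
  assumes f: "f \<in> order_ideal V C i" and h: "h \<in> order_ideal V C j"
  shows "f * h \<in> order_ideal V C (i + j)"
proof -
  interpret cring "mpoly_ring V :: ('a, 'b) mpoly ring" by (rule cring_mpoly_ring)
  have "f * h \<in> carrier (mpoly_ring V)"
    using f h m_closed[of f h] by (simp add: order_ideal_def)
  moreover have "i + j \<le> (\<Sum>x\<in>C. Poly_Mapping.lookup t x)"
    if t: "t \<in> Poly_Mapping.keys (f * h)" for t
  proof -
    obtain a b where "t = a + b" "a \<in> Poly_Mapping.keys f" "b \<in> Poly_Mapping.keys h"
      using t Poly_Mapping.keys_mult[of f h] by blast
    then show ?thesis
      using f h by (simp add: order_ideal_def lookup_add sum.distrib add_mono)
  qed
  ultimately show ?thesis by (simp add: order_ideal_def)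
qed

lemma order_ideal_0: "order_ideal V C 0 = carrier (mpoly_ring V)"
  by (simp add: order_ideal_def)

lemma ideal_order_ideal:
  "ideal (order_ideal V C i :: ('v, 'k::comm_ring_1) mpoly set) (mpoly_ring V)"
proof -
  interpret cring "mpoly_ring V :: ('v, 'k) mpoly ring" by (rule cring_mpoly_ring)
  show ?thesis
  proof (rule idealI)
    show "subgroup (order_ideal V C i) (add_monoid (mpoly_ring V :: ('v, 'k) mpoly ring))"
    proof (rule add.subgroupI)
      fix f :: "('v, 'k) mpoly" assume f: "f \<in> order_ideal V C i"
      then have "- f \<in> order_ideal V C i"
        by (simp add: order_ideal_def mpoly_ring_def)
      moreover have "\<ominus>\<^bsub>mpoly_ring V\<^esub> f = - f"
        using f calculation by (intro minus_equality) (auto simp: order_ideal_def)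
      ultimately show "\<ominus>\<^bsub>mpoly_ring V\<^esub> f \<in> order_ideal V C i" by simp
    next
      have "0 \<in> (order_ideal V C i :: ('v, 'k) mpoly set)"
        using zero_closed by (simp add: order_ideal_def)
      then show "order_ideal V C i \<noteq> ({} :: ('v, 'k) mpoly set)" by blast
    qed (auto simp: order_ideal_add, auto simp: order_ideal_def)
  \<comment> \<open>Absorption of ring elements is the product rule with one order equal to 0, as
    order 0 imposes no condition.\<close>
  qed (use order_ideal_mult[of _ V C 0 _ i] order_ideal_mult[of _ V C i _ 0]
    in \<open>auto simp: order_ideal_0 intro: ring_axioms\<close>)
qed

lemma ideal_power_subset_order_ideal:
  assumes "I \<subseteq> order_ideal V C 1"
  shows "ideal_power V I i \<subseteq> order_ideal V C i"
proof (induction i)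
  case (Suc i)
  have "f \<in> order_ideal V C (Suc i)" if "f \<in> ideal_power V I (Suc i)" for f
    using that unfolding ideal_power_Suc
  proof (induction rule: ideal_prod.induct)
    case (prod f h)
    then show ?case
      using order_ideal_mult[of f V C i h 1] Suc assms by auto
  qed (simp add: order_ideal_add)
  then show ?case by blast
qed (unfold ideal_power_0 order_ideal_0, rule order_refl)

lemma Idl_Var_subset_order_ideal:
  assumes "finite C" "C \<subseteq> V"
  shows "Idl\<^bsub>mpoly_ring V\<^esub> (Var ` C :: ('v, 'k::comm_ring_1) mpoly set) \<subseteq> order_ideal V C 1"
proof (rule ring.genideal_minimal[OF ring_mpoly_ring ideal_order_ideal], rule image_subsetI)
  fix x assume "x \<in> C"
  then show "(Var x :: ('v, 'k) mpoly) \<in> order_ideal V C 1"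
    using assms Var_in_mpoly_ring[of x V]
    by (auto simp: order_ideal_def Var_def lookup_single when_def)
qed

section \<open>Edge ideals of finite clutters\<close>

text \<open>Symbolic powers refer to minimal covers only; this passes to arbitrary covers, so that
  minimality need not be checked for the covers used later.\<close>

lemma minimal_vertex_cover_below:
  assumes "finite C" "vertex_cover V E C"
  shows "\<exists>C'\<subseteq>C. minimal_vertex_cover V E C'"
  using assms
proof (induction rule: finite_psubset_induct)
  case (psubset C)
  show ?case
  proof (cases "minimal_vertex_cover V E C")
    case False
    then obtain C' where "C' \<subset> C" "vertex_cover V E C'"
      using psubset.prems by (auto simp: minimal_vertex_cover_def)
    then obtain C'' where "C'' \<subseteq> C'" "minimal_vertex_cover V E C''"
      using psubset.IH[of C'] by auto
    then show ?thesis
      using \<open>C' \<subset> C\<close> by (intro exI[of _ C'']) auto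
  qed auto
qed

lemma ideal_edge_ideal:
  assumes "finite V" "E \<subseteq> Pow V"
  shows "ideal (edge_ideal V E :: ('v, 'k::comm_ring_1) mpoly set) (mpoly_ring V)"
  unfolding edge_ideal_def
  by (intro ring.genideal_ideal[OF ring_mpoly_ring] image_subsetI prod_Var_in_mpoly_ring)
    (use assms in \<open>auto intro: finite_subset\<close>)

lemma edge_monomial_in_edge_ideal:
  assumes "finite V" "E \<subseteq> Pow V" "e \<in> E"
  shows "(\<Prod>x\<in>e. Var x :: ('v, 'k::comm_ring_1) mpoly) \<in> edge_ideal V E"
proof -
  have "(\<lambda>e. \<Prod>x\<in>e. Var x :: ('v, 'k) mpoly) ` E \<subseteq> edge_ideal V E"
    unfolding edge_ideal_def
    by (intro ring.genideal_self[OF ring_mpoly_ring] image_subsetI prod_Var_in_mpoly_ring)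
      (use assms in \<open>auto intro: finite_subset\<close>)
  then show ?thesis using assms(3) by blast
qed

text \<open>Each edge contains a vertex of \<open>C\<close>, so its monomial is a multiple of a
  generator of the right-hand side.\<close>

lemma edge_ideal_subset_Idl_cover:
  assumes fin: "finite V" and sub: "E \<subseteq> Pow V" and C: "vertex_cover V E C"
  shows "(edge_ideal V E :: ('v, 'k::comm_ring_1) mpoly set) \<subseteq> Idl\<^bsub>mpoly_ring V\<^esub> (Var ` C)"
proof -
  interpret cring "mpoly_ring V :: ('v, 'k) mpoly ring" by (rule cring_mpoly_ring)
  let ?J = "Idl\<^bsub>mpoly_ring V\<^esub> (Var ` C) :: ('v, 'k) mpoly set"
  have car: "(Var ` C :: ('v, 'k) mpoly set) \<subseteq> carrier (mpoly_ring V)"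
    using C by (auto simp: vertex_cover_def intro: Var_in_mpoly_ring)
  interpret J: ideal ?J "mpoly_ring V"
    using car by (rule genideal_ideal)
  have "(\<Prod>x\<in>e. Var x) \<in> ?J" if eE: "e \<in> E" for e
  proof -
    have e: "finite e" "e \<subseteq> V"
      using eE sub finite_subset[OF _ fin] by auto
    obtain y where y: "y \<in> C" "y \<in> e"
      using C eE by (auto simp: vertex_cover_def)
    have "Var y \<in> ?J"
      using genideal_self[OF car] y by blast
    from J.I_r_closed[OF this prod_Var_in_mpoly_ring[of "e - {y}" V]] show ?thesis
      using e y by (simp add: prod.remove[of e y] subset_iff)
  qed
  then show ?thesis
    unfolding edge_ideal_def by (intro genideal_minimal J.is_ideal) blast
qed

lemma edge_power_subset_symbolic_power:
  assumes "finite V" "E \<subseteq> Pow V"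
  shows "ideal_power V (edge_ideal V E) i \<subseteq> symbolic_power V E i"
proof
  fix f assume f: "f \<in> ideal_power V (edge_ideal V E :: ('a, 'b) mpoly set) i"
  have "f \<in> carrier (mpoly_ring V)"
    using ideal.Icarr[OF ideal_ideal_power[OF ideal_edge_ideal[OF assms]] f] .
  moreover have "f \<in> ideal_power V (Idl\<^bsub>mpoly_ring V\<^esub> (Var ` C)) i"
    if "minimal_vertex_cover V E C" for C
    using f ideal_power_mono[OF edge_ideal_subset_Idl_cover[OF assms, of C]] that
    unfolding minimal_vertex_cover_def by blast
  ultimately show "f \<in> symbolic_power V E i"
    by (simp add: symbolic_power_def)
qed

text \<open>A minimal cover inside \<open>C\<close> already gives weight at least \<open>i\<close>,
  and enlarging the set can only increase the weight.\<close>

lemma symbolic_power_subset_order_ideal: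
  fixes V C :: "'v set"
  assumes "finite V" "vertex_cover V E C"
  shows "(symbolic_power V E i :: ('v, 'k::comm_ring_1) mpoly set) \<subseteq> order_ideal V C i"
proof
  fix f :: "('v, 'k) mpoly" assume f: "f \<in> symbolic_power V E i"
  have CV: "C \<subseteq> V" using assms(2) by (simp add: vertex_cover_def)
  then have finC: "finite C" using assms(1) by (rule finite_subset)
  obtain C' where C': "C' \<subseteq> C" "minimal_vertex_cover V E C'"
    using minimal_vertex_cover_below[OF finC assms(2)] by blast
  have "f \<in> ideal_power V (Idl\<^bsub>mpoly_ring V\<^esub> (Var ` C')) i"
    using f C'(2) by (simp add: symbolic_power_def)
  also have "\<dots> \<subseteq> order_ideal V C' i"
    using C'(1) CV finC
    by (intro ideal_power_subset_order_ideal Idl_Var_subset_order_ideal) (auto intro: finite_subset)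
  also have "\<dots> \<subseteq> order_ideal V C i"
    using sum_mono2[OF finC C'(1)] by (auto simp: order_ideal_def intro: order_trans)
  finally show "f \<in> order_ideal V C i" .
qed

text \<open>Assumption \<open>mem\<close> closes a circle: powers lie in symbolic powers, these obey
  the weight bound on every cover, and \<open>mem\<close> leads back to powers. The integral closure
  joins in because weights scale with exponents.\<close>

lemma normality_if_order_monomials:
  fixes V :: "'v set" and E :: "'v set set"
  defines "I \<equiv> edge_ideal V E :: ('v, 'k::comm_ring_1) mpoly set"
  assumes fin: "finite V" and sub: "E \<subseteq> Pow V"
    and mem: "\<And>i t. Poly_Mapping.keys t \<subseteq> V \<Longrightarrow>
      (\<And>C. vertex_cover V E C \<Longrightarrow> i \<le> (\<Sum>x\<in>C. Poly_Mapping.lookup t x)) \<Longrightarrow>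
      Poly_Mapping.single t 1 \<in> ideal_power V I i"
  shows "normally_torsion_free V E I" "normal_monomial_ideal V I"
proof -
  interpret cring "mpoly_ring V :: ('v, 'k) mpoly ring" by (rule cring_mpoly_ring)
  have ideal: "ideal (ideal_power V I i) (mpoly_ring V)" for i
    unfolding I_def by (intro ideal_ideal_power ideal_edge_ideal fin sub)
  have symb: "ideal_power V I i \<subseteq> symbolic_power V E i" for i
    unfolding I_def by (intro edge_power_subset_symbolic_power fin sub)
  note order = symbolic_power_subset_order_ideal[OF fin]
  have monomial: "Poly_Mapping.single t 1 \<in> ideal_power V I i"
    if "f \<in> symbolic_power V E i" "t \<in> Poly_Mapping.keys f"
    for f :: "('v, 'k) mpoly" and t i
  proof (rule mem)
    show "Poly_Mapping.keys t \<subseteq> V"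
      using that by (auto simp: symbolic_power_def mpoly_ring_def)
    show "i \<le> (\<Sum>x\<in>C. Poly_Mapping.lookup t x)" if "vertex_cover V E C" for C
      using order[OF that, of i] \<open>f \<in> symbolic_power V E i\<close> \<open>t \<in> Poly_Mapping.keys f\<close>
      by (auto simp: order_ideal_def)
  qed
  have "symbolic_power V E i \<subseteq> ideal_power V I i" for i
    using ideal_mem_if_monomials[OF ideal[of i]] monomial
    by (fastforce simp: symbolic_power_def)
  with symb show "normally_torsion_free V E I"
    unfolding normally_torsion_free_def by blast
  have "ideal_power V I i = integral_closure_power V I i" for i
  proof
    let ?M = "{m \<in> monomials V. \<exists>p\<ge>1. m ^ p \<in> ideal_power V I (p * i)}"
    have "?M \<subseteq> carrier (mpoly_ring V)"
      by (auto simp: monomials_def single_in_mpoly_ring)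
    note closure_ideal = genideal_ideal[OF this] and gen = genideal_self[OF this]
    show "ideal_power V I i \<subseteq> integral_closure_power V I i"
    proof
      fix f assume f: "f \<in> ideal_power V I i"
      have car: "f \<in> carrier (mpoly_ring V)"
        using ideal.Icarr[OF ideal f] .
      have "Poly_Mapping.single t 1 \<in> ?M" if "t \<in> Poly_Mapping.keys f" for t
      proof -
        \<comment> \<open>The witness is \<open>p = 1\<close>. That the monomials of
          \<open>f\<close> belong to the power along with \<open>f\<close> comes from the detour
          through the symbolic power.\<close>
        have "Poly_Mapping.single t 1 ^ 1 \<in> ideal_power V I (1 * i)"
          using monomial[of f i t] symb f that by auto
        moreover have "Poly_Mapping.single t 1 \<in> monomials V"
          using car that by (auto simp: monomials_def mpoly_ring_def)
        ultimately show ?thesis by blast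
      qed
      then show "f \<in> integral_closure_power V I i"
        unfolding integral_closure_power_def
        using gen by (intro ideal_mem_if_monomials[OF closure_ideal car]) blast
    qed
    have "Poly_Mapping.single t 1 \<in> ideal_power V I i"
      if t: "Poly_Mapping.keys t \<subseteq> V" and "p \<ge> 1"
        and p: "Poly_Mapping.single t 1 ^ p \<in> ideal_power V I (p * i)" for t p
    proof (rule mem[OF t])
      fix C assume C: "vertex_cover V E C"
      obtain s where s: "Poly_Mapping.single t (1::'k) ^ p = Poly_Mapping.single s 1"
        "\<And>x. Poly_Mapping.lookup s x = p * Poly_Mapping.lookup t x"
        using single_1_power[of t p, where 'k = 'k] by blast
      then have "Poly_Mapping.single s (1::'k) \<in> order_ideal V C (p * i)"
        using order[OF C] symb p by (metis subsetD)
      \<comment> \<open>Raising to the power \<open>p\<close> multiplies the weight by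
        \<open>p\<close>, so the factor \<open>p \<ge> 1\<close> cancels.\<close>
      then have "p * i \<le> p * (\<Sum>x\<in>C. Poly_Mapping.lookup t x)"
        by (simp add: order_ideal_def s(2) sum_distrib_left)
      then show "i \<le> (\<Sum>x\<in>C. Poly_Mapping.lookup t x)"
        using \<open>p \<ge> 1\<close> by simp
    qed
    then show "integral_closure_power V I i \<subseteq> ideal_power V I i"
      unfolding integral_closure_power_def
      by (intro genideal_minimal ideal) (auto simp: monomials_def)
  qed
  then show "normal_monomial_ideal V I"
    by (simp add: normal_monomial_ideal_def)
qed

section \<open>Complete admissible uniform clutters\<close>

context
  fixes d g :: nat and x :: "nat \<Rightarrow> nat \<Rightarrow> 'v" and V :: "'v set" and E :: "'v set set"
  assumes d: "1 \<le> d"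
    and inj: "inj_on (\<lambda>(j, k). x j k) ({1..d} \<times> {1..g})"
    and V: "V = (\<Union>j\<in>{1..d}. x j ` {1..g})"
    and E: "E = {(\<lambda>j. x j (c j)) ` {1..d} | c. c \<in> {1..d} \<rightarrow> {1..g} \<and> mono_on {1..d} c}"
begin

lemma x_eq_iff:
  "j \<in> {1..d} \<Longrightarrow> k \<in> {1..g} \<Longrightarrow> j' \<in> {1..d} \<Longrightarrow> k' \<in> {1..g} \<Longrightarrow>
    x j k = x j' k' \<longleftrightarrow> j = j' \<and> k = k'"
  using inj_onD[OF inj, of "(j, k)" "(j', k')"] by auto

lemma finite_vertices: "finite V"
  by (simp add: V)

lemma edges_subset: "E \<subseteq> Pow V"
  by (auto simp: V E Pi_iff)

definition staircase_cover :: "(nat \<Rightarrow> nat) \<Rightarrow> 'v set"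
  where "staircase_cover l = (\<lambda>(j, k). x j k) ` (SIGMA j:{1..d}. {l (j - 1)<..l j})"

lemma staircase_subset:
  assumes "staircase d g l"
  shows "(SIGMA j:{1..d}. {l (j - 1)<..l j}) \<subseteq> {1..d} \<times> {1..g}"
proof -
  have "l j \<le> g" if "j \<in> {1..d}" for j
    using assms that by (auto simp: staircase_def mono_on_def)
  then show ?thesis by fastforce
qed

lemma vertex_cover_staircase_cover:
  assumes "staircase d g l"
  shows "vertex_cover V E (staircase_cover l)"
  unfolding vertex_cover_def
proof (intro conjI ballI)
  show "staircase_cover l \<subseteq> V"
    using staircase_subset[OF assms] by (auto simp: staircase_cover_def V)
  fix e assume "e \<in> E"
  then obtain c where c: "c \<in> {1..d} \<rightarrow> {1..g}" "mono_on {1..d} c" "e = (\<lambda>j. x j (c j)) ` {1..d}"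
    by (auto simp: E)
  obtain j where "j \<in> {1..d}" "l (j - 1) < c j" "c j \<le> l j"
    using staircase_meets_chain[OF assms d c(1,2)] .
  then have "x j (c j) \<in> staircase_cover l \<inter> e"
    by (force simp: staircase_cover_def c(3))
  then show "staircase_cover l \<inter> e \<noteq> {}" by blast
qed

text \<open>The labelling \<open>x\<close> is injective on the grid, so summing over vertices is
  summing over index pairs.\<close>

lemma sum_staircase_cover:
  assumes "staircase d g l"
  shows "(\<Sum>y\<in>staircase_cover l. f y) = staircase_weight d (\<lambda>j k. f (x j k)) l"
  unfolding staircase_cover_def staircase_weight_def
  by (subst sum.reindex[OF inj_on_subset[OF inj staircase_subset[OF assms]]])
    (simp add: sum.Sigma case_prod_unfold)

text \<open>Induction on \<open>i\<close>: \<open>removable_chain\<close> yields an edge whose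
  monomial divides the given one and leaves a quotient of weight at least \<open>i\<close> on every
  staircase.\<close>

lemma monomial_in_edge_power:
  assumes "Poly_Mapping.keys t \<subseteq> V"
    and "\<And>l. staircase d g l \<Longrightarrow> i \<le> staircase_weight d (\<lambda>j k. Poly_Mapping.lookup t (x j k)) l"
  shows "Poly_Mapping.single t (1::'k::comm_ring_1) \<in> ideal_power V (edge_ideal V E) i"
  using assms
proof (induction i arbitrary: t)
  case 0
  then show ?case
    unfolding ideal_power_0 by (intro single_in_mpoly_ring)
next
  case (Suc i)
  obtain c where c: "c \<in> {1..d} \<rightarrow> {1..g}" "mono_on {1..d} c"
    and pos: "\<And>j. j \<in> {1..d} \<Longrightarrow> 0 < Poly_Mapping.lookup t (x j (c j))"
    and rest: "\<And>l. staircase d g l \<Longrightarrow>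
      i \<le> staircase_weight d (\<lambda>j k. Poly_Mapping.lookup t (x j k) - of_bool (k = c j)) l"
    using removable_chain[OF d Suc.prems(2)] by blast
  define e where "e = (\<lambda>j. x j (c j)) ` {1..d}"
  define s where "s = (\<Sum>y\<in>e. Poly_Mapping.single y (1::nat))"
  have e: "finite e" "e \<in> E"
    using c by (auto simp: e_def E)
  have lookup_s: "Poly_Mapping.lookup s y = of_bool (y \<in> e)" for y
    unfolding s_def using e(1) by (rule lookup_sum_single)
  \<comment> \<open>Subtraction of exponents truncates at 0; it is exact here because
    \<open>t\<close> is positive on the whole edge.\<close>
  have t: "t = (t - s) + s"
    by (rule poly_mapping_eqI)
      (use pos in \<open>auto simp: lookup_add lookup_minus lookup_s e_def Suc_leI\<close>)
  have "Poly_Mapping.single (t - s) (1::'k) \<in> ideal_power V (edge_ideal V E) i"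
  proof (rule Suc.IH)
    show "Poly_Mapping.keys (t - s) \<subseteq> V"
      using Suc.prems(1) by (auto simp: in_keys_iff lookup_minus)
    fix l assume l: "staircase d g l"
    \<comment> \<open>By injectivity of the labelling, the edge has exactly one vertex in each
      layer, so dividing by its monomial is the reduction that appears in
      \<open>rest\<close>.\<close>
    have "x j k \<in> e \<longleftrightarrow> k = c j" if "j \<in> {1..d}" "k \<in> {1..g}" for j k
      using that c(1) by (auto simp: e_def x_eq_iff Pi_iff)
    then have "staircase_weight d (\<lambda>j k. Poly_Mapping.lookup (t - s) (x j k)) l =
        staircase_weight d (\<lambda>j k. Poly_Mapping.lookup t (x j k) - of_bool (k = c j)) l"
      unfolding staircase_weight_def
      using staircase_subset[OF l]
      by (intro sum.cong refl) (auto simp: lookup_minus lookup_s subset_iff)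
    then show "i \<le> staircase_weight d (\<lambda>j k. Poly_Mapping.lookup (t - s) (x j k)) l"
      using rest[OF l] by simp
  qed
  moreover have "(\<Prod>y\<in>e. Var y :: ('v, 'k) mpoly) \<in> edge_ideal V E"
    using edge_monomial_in_edge_ideal[OF finite_vertices edges_subset e(2)] .
  ultimately have "Poly_Mapping.single (t - s) 1 * (\<Prod>y\<in>e. Var y :: ('v, 'k) mpoly)
      \<in> ideal_power V (edge_ideal V E) (Suc i)"
    unfolding ideal_power_Suc
    by (subst mpoly_ring_simps(2)[symmetric]) (rule ideal_prod.prod)
  then show ?case
    unfolding prod_Var[OF e(1)] s_def[symmetric] mult_single mult_1_right t[symmetric] .
qed

text \<open>The weight bound assumed for all vertex covers is applied to the staircase
  covers.\<close>

lemma clutter_normality: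
  "normally_torsion_free V E (edge_ideal V E :: ('v, 'k::comm_ring_1) mpoly set)"
  "normal_monomial_ideal V (edge_ideal V E :: ('v, 'k::comm_ring_1) mpoly set)"
proof -
  have "Poly_Mapping.single t (1::'c::comm_ring_1) \<in> ideal_power V (edge_ideal V E) i"
    if "Poly_Mapping.keys t \<subseteq> V"
      "\<And>C. vertex_cover V E C \<Longrightarrow> i \<le> (\<Sum>y\<in>C. Poly_Mapping.lookup t y)" for i t
    using that vertex_cover_staircase_cover
    by (intro monomial_in_edge_power) (simp_all flip: sum_staircase_cover)
  note normality_if_order_monomials[OF finite_vertices edges_subset this]
  then show "normally_torsion_free V E (edge_ideal V E :: ('v, 'k::comm_ring_1) mpoly set)"
    "normal_monomial_ideal V (edge_ideal V E :: ('v, 'k::comm_ring_1) mpoly set)"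
    by blast+
qed

end

theorem theorem4p2p3:
  fixes d g :: nat
    and V :: "'v set"
    and E :: "'v set set"
    and I :: "('v, 'k::field) mpoly set"
  assumes "d \<ge> 2" and "g \<ge> 2"
    and "complete_admissible_uniform_clutter d g V E"
    and "I = edge_ideal V E"
  shows "normally_torsion_free V E I \<and> normal_monomial_ideal V I"
proof -
  obtain x :: "nat \<Rightarrow> nat \<Rightarrow> 'v" where x: "inj_on (\<lambda>(j, k). x j k) ({1..d} \<times> {1..g})"
    "V = (\<Union>j\<in>{1..d}. x j ` {1..g})"
    "E = {(\<lambda>j. x j (c j)) ` {1..d} | c. c \<in> {1..d} \<rightarrow> {1..g} \<and> mono_on {1..d} c}"
    using assms(3) unfolding complete_admissible_uniform_clutter_def by auto
  have "1 \<le> d" using assms(1) by simp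
  from clutter_normality[OF this x] show ?thesis
    by (simp add: assms(4))
qed

end
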